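(* Let $G = C_{2k}^d$ be the $d$th power of the cartesian product of the even cycle $C_{2k}$ with itself. If $\varphi$ is a $2d$-edge coloring of a distance-$4$ matching $M$ of $G$ (that is, an assignment of colors from $\{1,\dots,2d\}$ to the edges of $M$), then $\varphi$ can be extended to a proper $2d$-edge coloring of $G$, i.e. there is a proper edge coloring $f : E(G) \to \{1,\dots,2d\}$ such that $f(e) = \varphi(e)$ for every $e \in M$.
   Context: $C_n$ denotes the (simple) cycle with $n$ vertices, $n \geq 3$. The cartesian product $G \square H$ of two graphs $G$ and $H$ is the graph with vertex set $V(G)\times V(H)$, where $(u,v)$ is adjacent to $(u',v')$ if and only if $u=u'$ and $vv' \in E(H)$, or $uu' \in E(G)$ and $v=v'$. For a positive integer $d$, $G^d$ denotes the $d$-fold cartesian product $G \square G \square \cdots \square G$ ($d$ factors). The distance between two edges $e$ and $e'$ is the number of edges in a shortest path between an endpoint of $e$ and an endpoint of $e'$. A distance-$t$ matching is a matching in which any two distinct edges are at distance at least $t$ from each other. A proper $t$-edge coloring of $G$ is an assignment of colors from $\{1,\dots,t\}$ to all edges of $G$ such that any two edges sharing an endpoint receive different colors.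
   Formalization: The formal theorem assumes d ≥ 2: for d = 1 the claim fails, e.g. in C_10 with M = {{0,1},{5,6}} both coloured 1, since a proper 2-edge coloring alternates and gives these two edges different colors. *)

theory Defs
  imports Main "HOL-Library.Extended_Nat" "HOL-Library.Disjoint_Sets"
begin

text \<open>Undirected graphs: an edge is the set of its endpoints.\<close>

record 'a ugraph =
  verts :: "'a set"
  edges :: "'a set set"

text \<open>For \<open>n \<ge> 3\<close> this is the simple cycle on \<open>n\<close> vertices; the edges collapse for smaller \<open>n\<close>.\<close>

definition cycle_graph :: "nat \<Rightarrow> nat ugraph" where
  "cycle_graph n = \<lparr>verts = {0..<n}, edges = {{i, Suc i mod n} | i. i < n}\<rparr>"

definition cart_prod :: "'a ugraph \<Rightarrow> 'b ugraph \<Rightarrow> ('a \<times> 'b) ugraph"  (infixr "\<box>" 70) where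
  "G \<box> H = \<lparr>verts = verts G \<times> verts H,
            edges = {{(u, v), (u', v')} | u v u' v'.
                       u \<in> verts G \<and> u' \<in> verts G \<and> v \<in> verts H \<and> v' \<in> verts H \<and>
                       (u = u' \<and> {v, v'} \<in> edges H \<or> {u, u'} \<in> edges G \<and> v = v')}\<rparr>"

definition map_ugraph :: "('a \<Rightarrow> 'b) \<Rightarrow> 'a ugraph \<Rightarrow> 'b ugraph" where
  "map_ugraph f G = \<lparr>verts = f ` verts G, edges = (\<lambda>e. f ` e) ` edges G\<rparr>"

text \<open>The vertices of the \<open>d\<close>-fold product are lists of length \<open>d\<close>, so that all powers have the
  same type; a pair \<open>(x, xs)\<close> of the binary product is renamed to \<open>x # xs\<close>. The \<open>0\<close>-th power is
  the one-vertex graph, the unit of the product up to isomorphism.\<close>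

primrec cart_power :: "'a ugraph \<Rightarrow> nat \<Rightarrow> 'a list ugraph" where
  "cart_power G 0 = \<lparr>verts = {[]}, edges = {}\<rparr>"
| "cart_power G (Suc d) = map_ugraph (\<lambda>(x, xs). x # xs) (G \<box> cart_power G d)"

lemma verts_cart_power:
  "verts (cart_power G d) = {xs. length xs = d \<and> set xs \<subseteq> verts G}"
  by (induction d) (auto simp: map_ugraph_def cart_prod_def length_Suc_conv image_iff)

text \<open>Two vertices of a power are adjacent iff they differ in one coordinate \<open>i\<close> only, and their
  entries there are adjacent.\<close>

lemma edges_cart_power:
  assumes "\<And>x. {x} \<notin> edges G"
  shows "{xs, ys} \<in> edges (cart_power G d) \<longleftrightarrow>
    xs \<in> verts (cart_power G d) \<and> ys \<in> verts (cart_power G d) \<and>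
    (\<exists>i<d. {xs ! i, ys ! i} \<in> edges G \<and> (\<forall>j<d. j \<noteq> i \<longrightarrow> xs ! j = ys ! j))"
proof (induction d arbitrary: xs ys)
  case 0
  show ?case by simp
next
  case (Suc d)
  have step: "{xs, ys} \<in> edges (cart_power G (Suc d)) \<longleftrightarrow>
    (\<exists>u us v vs. xs = u # us \<and> ys = v # vs \<and> u \<in> verts G \<and> v \<in> verts G \<and>
       us \<in> verts (cart_power G d) \<and> vs \<in> verts (cart_power G d) \<and>
       (u = v \<and> {us, vs} \<in> edges (cart_power G d) \<or> {u, v} \<in> edges G \<and> us = vs))"
    (is "?L \<longleftrightarrow> ?R")
  proof
    assume ?L
    then obtain u us v vs where *: "{xs, ys} = {u # us, v # vs}" "u \<in> verts G" "v \<in> verts G"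
      "us \<in> verts (cart_power G d)" "vs \<in> verts (cart_power G d)"
      "u = v \<and> {us, vs} \<in> edges (cart_power G d) \<or> {u, v} \<in> edges G \<and> us = vs"
      by (auto simp: map_ugraph_def cart_prod_def)
    then consider "xs = u # us" "ys = v # vs" | "xs = v # vs" "ys = u # us"
      by (auto simp: doubleton_eq_iff)
    then show ?R
      by cases (use * in \<open>auto simp: insert_commute\<close>)
  next
    assume ?R
    then obtain u us v vs where *: "xs = u # us" "ys = v # vs" "u \<in> verts G" "v \<in> verts G"
      "us \<in> verts (cart_power G d)" "vs \<in> verts (cart_power G d)"
      "u = v \<and> {us, vs} \<in> edges (cart_power G d) \<or> {u, v} \<in> edges G \<and> us = vs"
      by blast
    then have "{(u, us), (v, vs)} \<in> edges (G \<box> cart_power G d)"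
      by (auto simp: cart_prod_def)
    moreover have "{xs, ys} = (\<lambda>(x, xs). x # xs) ` {(u, us), (v, vs)}"
      using * by simp
    ultimately show ?L
      unfolding cart_power.simps map_ugraph_def ugraph.simps by blast
  qed
  show ?case
  proof (cases "length xs = Suc d \<and> length ys = Suc d")
    case False
    then show ?thesis
      by (subst step) (auto simp: verts_cart_power simp del: cart_power.simps(2))
  next
    case True
    then obtain u us v vs where eq: "xs = u # us" "ys = v # vs" "length us = d" "length vs = d"
      by (auto simp: length_Suc_conv)
    have ex: "(\<exists>i<Suc d. P i) \<longleftrightarrow> P 0 \<or> (\<exists>i<d. P (Suc i))"
      and all: "(\<forall>i<Suc d. P i) \<longleftrightarrow> P 0 \<and> (\<forall>i<d. P (Suc i))" for P
      by (auto simp: less_Suc_eq_0_disj)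
    have eqv: "us = vs \<longleftrightarrow> (\<forall>j<d. us ! j = vs ! j)"
      using eq by (auto simp: list_eq_iff_nth_eq)
    show ?thesis
      unfolding step unfolding eq(1,2) ex all using eq(3,4) assms
      by (auto simp: Suc.IH verts_cart_power eqv simp del: cart_power.simps(2))
  qed
qed

definition is_path :: "'a ugraph \<Rightarrow> 'a list \<Rightarrow> bool" where
  "is_path G p \<longleftrightarrow> p \<noteq> [] \<and> set p \<subseteq> verts G \<and> distinct p \<and>
     successively (\<lambda>u v. {u, v} \<in> edges G) p"

text \<open>The value is \<open>\<infinity>\<close> if no path joins the two edges.\<close>

definition edge_dist :: "'a ugraph \<Rightarrow> 'a set \<Rightarrow> 'a set \<Rightarrow> enat" where
  "edge_dist G e e' = (INF p \<in> {p. is_path G p \<and> hd p \<in> e \<and> last p \<in> e'}. enat (length p - 1))"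

definition matching :: "'a ugraph \<Rightarrow> 'a set set \<Rightarrow> bool" where
  "matching G M \<longleftrightarrow> M \<subseteq> edges G \<and> disjoint M"

definition distance_matching :: "'a ugraph \<Rightarrow> nat \<Rightarrow> 'a set set \<Rightarrow> bool" where
  "distance_matching G t M \<longleftrightarrow> matching G M \<and>
     (\<forall>e\<in>M. \<forall>e'\<in>M. e \<noteq> e' \<longrightarrow> enat t \<le> edge_dist G e e')"

definition proper_edge_coloring :: "'a ugraph \<Rightarrow> nat \<Rightarrow> ('a set \<Rightarrow> nat) \<Rightarrow> bool" where
  "proper_edge_coloring G t f \<longleftrightarrow> (\<forall>e\<in>edges G. f e \<in> {1..t}) \<and>
     (\<forall>e\<in>edges G. \<forall>e'\<in>edges G. e \<noteq> e' \<and> e \<inter> e' \<noteq> {} \<longrightarrow> f e \<noteq> f e')"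

end

theory Submission
  imports Defs "HOL-Combinatorics.Transposition"
begin

text \<open>
  Give the cycles of direction \<open>i\<close> (counted from \<open>0\<close>) the colours \<open>2i + 1\<close> and \<open>2i + 2\<close>
  alternately; as the cycles are even, this is a proper colouring with \<open>2d\<close> colours in which
  every vertex sees every colour. It is then corrected at each edge \<open>e = {u, v}\<close> of the matching
  separately. Let \<open>a\<close> be the present and \<open>b\<close> the prescribed colour of \<open>e\<close>.

  If \<open>a\<close> and \<open>b\<close> belong to different directions, then \<open>e\<close> lies on a 4-cycle whose edges are
  coloured \<open>a, b, a, b\<close>, and exchanging the two colours on that cycle gives \<open>e\<close> the colour \<open>b\<close>.
  If \<open>a\<close> and \<open>b\<close> are the two colours of one direction, choose a colour \<open>c\<close> of another direction,
  which exists because \<open>d \<ge> 2\<close>. The two \<open>b\<close>-edges next to \<open>e\<close> lie on 4-cycles coloured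
  \<open>b, c, b, c\<close>; once these are exchanged, the edges of colour \<open>c\<close> at \<open>u\<close> and \<open>v\<close> have become
  \<open>b\<close>-edges, so \<open>e\<close> now lies on a 4-cycle coloured \<open>a, b, a, b\<close>, which is exchanged in turn.

  In both cases every recoloured edge has an endpoint at distance at most 1 from \<open>e\<close>. An edge
  recoloured for two edges \<open>e\<close> and \<open>e'\<close> of the matching would join them by a walk of length at most
  \<open>1 + 1 + 1 = 3\<close>, so at distance 4 the corrections never meet in an edge
  (\<open>touches_unique\<close>). They may meet in a vertex, but there each of them only permutes the colours
  of its own edges, so carrying out all of them leaves the colouring proper
  (\<open>combine_local_recolorings\<close>).

  The colour classes of the initial colouring are perfect matchings, that is, fixed-point free
  involutions \<open>\<sigma> c\<close> of the vertex set. In these terms, colours of different directions have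
  commuting involutions, and commutation is what provides the 4-cycles. The argument is carried out
  for graphs described in this way.
\<close>

section \<open>Short walks between edges\<close>

text \<open>Distances are defined by paths without repeated vertices, whereas the walks met below may repeat
  vertices. Prepending a vertex that already occurs is repaired by discarding everything before
  that occurrence.\<close>

lemma is_path_extend:
  assumes "is_path G p" "x \<in> verts G" "x = hd p \<or> {x, hd p} \<in> edges G"
  shows "\<exists>q. is_path G q \<and> hd q = x \<and> last q = last p \<and> length q \<le> Suc (length p)"
proof (cases "x \<in> set p")
  case True
  then obtain ys zs where p: "p = ys @ x # zs"
    by (auto simp: in_set_conv_decomp)
  have "is_path G (x # zs)"
    using assms(1) by (auto simp: p is_path_def successively_append_iff)
  then show ?thesis
    by (intro exI[of _ "x # zs"]) (simp add: p)
next
  case False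
  have "p \<noteq> []"
    using assms(1) by (simp add: is_path_def)
  then have "x \<noteq> hd p"
    using False hd_in_set by metis
  then have "is_path G (x # p)"
    using assms False by (auto simp: is_path_def successively_Cons)
  then show ?thesis
    using \<open>p \<noteq> []\<close> by (intro exI[of _ "x # p"]) simp
qed

lemma edge_dist_le_3:
  assumes "set [w, x, y, z] \<subseteq> verts G" "w \<in> e" "z \<in> e'"
    and "w = x \<or> {w, x} \<in> edges G" "x = y \<or> {x, y} \<in> edges G" "y = z \<or> {y, z} \<in> edges G"
  shows "edge_dist G e e' \<le> enat 3"
proof -
  have "is_path G [z]"
    using assms(1) by (simp add: is_path_def)
  from is_path_extend[OF this, of y] obtain p where p: "is_path G p" "hd p = y" "last p = z"
      "length p \<le> 2"
    using assms by auto
  from is_path_extend[OF this(1), of x] obtain q where q: "is_path G q" "hd q = x" "last q = z"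
      "length q \<le> 3"
    using assms p by auto
  from is_path_extend[OF this(1), of w] obtain r where r: "is_path G r" "hd r = w" "last r = z"
      "length r \<le> 4"
    using assms q by auto
  have "edge_dist G e e' \<le> enat (length r - 1)"
    unfolding edge_dist_def using r assms by (intro INF_lower) auto
  also have "\<dots> \<le> enat 3"
    using r by simp
  finally show ?thesis .
qed

section \<open>Colourings given by involutions\<close>

text \<open>A regular graph whose edges are properly coloured so that every vertex sees every colour of \<open>C\<close>:
  \<open>\<sigma> c x\<close> is the neighbour of \<open>x\<close> along the edge of colour \<open>c\<close>.\<close>

locale involution_graph =
  fixes G :: "'a ugraph" and C :: "nat set" and \<sigma> :: "nat \<Rightarrow> 'a \<Rightarrow> 'a"
  assumes closed: "c \<in> C \<Longrightarrow> x \<in> verts G \<Longrightarrow> \<sigma> c x \<in> verts G"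
    and invol: "c \<in> C \<Longrightarrow> x \<in> verts G \<Longrightarrow> \<sigma> c (\<sigma> c x) = x"
    and no_fixpoint: "c \<in> C \<Longrightarrow> x \<in> verts G \<Longrightarrow> \<sigma> c x \<noteq> x"
    and simple: "c \<in> C \<Longrightarrow> c' \<in> C \<Longrightarrow> x \<in> verts G \<Longrightarrow> \<sigma> c x = \<sigma> c' x \<Longrightarrow> c = c'"
    and edges_eq: "edges G = {{x, \<sigma> c x} | x c. x \<in> verts G \<and> c \<in> C}"
begin

text \<open>A new colouring is described relative to the one given by \<open>\<sigma>\<close>: \<open>\<pi> x c\<close> is the new colour of
  \<open>{x, \<sigma> c x}\<close>. The last conjunct says that both endpoints agree on it; injectivity says that the
  new colouring is proper at \<open>x\<close>.\<close>

definition compatible :: "('a \<Rightarrow> nat \<Rightarrow> nat) \<Rightarrow> bool" where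
  "compatible \<pi> \<longleftrightarrow> (\<forall>x\<in>verts G. inj_on (\<pi> x) C \<and> \<pi> x ` C \<subseteq> C \<and>
     (\<forall>c\<in>C. \<pi> (\<sigma> c x) c = \<pi> x c))"

definition near :: "'a set \<Rightarrow> 'a \<Rightarrow> bool" where
  "near e x \<longleftrightarrow> (\<exists>y\<in>e. y = x \<or> {y, x} \<in> edges G)"

text \<open>This property of the edge \<open>{x, \<sigma> c x}\<close> holds of all edges that are recoloured for the sake of
  \<open>e\<close>, and for at most one edge \<open>e\<close> of a distance-4 matching.\<close>

definition touches :: "'a set \<Rightarrow> 'a \<Rightarrow> nat \<Rightarrow> bool" where
  "touches e x c \<longleftrightarrow> near e x \<or> near e (\<sigma> c x)"

definition local_recoloring :: "'a set \<Rightarrow> ('a \<Rightarrow> nat \<Rightarrow> nat) \<Rightarrow> bool" where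
  "local_recoloring e \<pi> \<longleftrightarrow> compatible \<pi> \<and>
     (\<forall>x\<in>verts G. \<forall>c\<in>C. \<pi> x c \<noteq> c \<longrightarrow> touches e x c)"

lemma edgeI: "x \<in> verts G \<Longrightarrow> c \<in> C \<Longrightarrow> {x, \<sigma> c x} \<in> edges G"
  by (auto simp: edges_eq)

lemma edge_at:
  assumes "e \<in> edges G" "z \<in> e"
  obtains c where "c \<in> C" "z \<in> verts G" "e = {z, \<sigma> c z}"
proof -
  obtain x c where xc: "x \<in> verts G" "c \<in> C" "e = {x, \<sigma> c x}"
    using assms(1) by (auto simp: edges_eq)
  have "z = x \<or> z = \<sigma> c x"
    using assms(2) xc by simp
  then have "z \<in> verts G \<and> e = {z, \<sigma> c z}"
    using closed[OF xc(2,1)] invol[OF xc(2,1)] xc(1,3) by (auto simp: insert_commute)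
  then show thesis
    using that xc(2) by blast
qed

lemma edge_color_unique:
  assumes "{x, \<sigma> c x} = {y, \<sigma> c' y}" "x \<in> verts G" "y \<in> verts G" "c \<in> C" "c' \<in> C"
  shows "c = c'"
proof (cases "x = y")
  case True
  then show ?thesis
    using assms simple by (metis doubleton_eq_iff)
next
  case False
  then have "x = \<sigma> c' y" "\<sigma> c x = y"
    using assms(1) by (auto simp: doubleton_eq_iff)
  then show ?thesis
    using assms simple invol by metis
qed

lemma coloring_of_compatible:
  assumes comp: "compatible \<pi>" and C: "C = {1..t}"
  obtains f where "proper_edge_coloring G t f"
    "\<And>x c. x \<in> verts G \<Longrightarrow> c \<in> C \<Longrightarrow> f {x, \<sigma> c x} = \<pi> x c"
proof -
  define f where "f e = (SOME k. \<exists>x\<in>verts G. \<exists>c\<in>C. e = {x, \<sigma> c x} \<and> k = \<pi> x c)" for e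
  have f: "f {x, \<sigma> c x} = \<pi> x c" if xc: "x \<in> verts G" "c \<in> C" for x c
  proof -
    have "\<exists>k. \<exists>y\<in>verts G. \<exists>c'\<in>C. {x, \<sigma> c x} = {y, \<sigma> c' y} \<and> k = \<pi> y c'"
      using xc by blast
    from someI_ex[OF this] obtain y c' where y: "y \<in> verts G" "c' \<in> C"
      "{x, \<sigma> c x} = {y, \<sigma> c' y}" "f {x, \<sigma> c x} = \<pi> y c'"
      by (auto simp: f_def)
    then have "c' = c"
      using edge_color_unique xc by metis
    moreover have "y = x \<or> y = \<sigma> c x"
      using y(3) by (auto simp: doubleton_eq_iff)
    ultimately show ?thesis
      using y(4) comp xc by (auto simp: compatible_def)
  qed
  have "proper_edge_coloring G t f"
    unfolding proper_edge_coloring_def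
  proof (intro conjI ballI impI)
    fix e assume "e \<in> edges G"
    then obtain x c where xc: "x \<in> verts G" "c \<in> C" "e = {x, \<sigma> c x}"
      by (auto simp: edges_eq)
    then have "\<pi> x c \<in> C"
      using comp unfolding compatible_def by blast
    then show "f e \<in> {1..t}"
      using f xc C by simp
  next
    fix e e' assume e: "e \<in> edges G" "e' \<in> edges G" and ne: "e \<noteq> e' \<and> e \<inter> e' \<noteq> {}"
    then obtain z where z: "z \<in> e" "z \<in> e'"
      by blast
    obtain c where c: "c \<in> C" "z \<in> verts G" "e = {z, \<sigma> c z}"
      using edge_at[OF e(1) z(1)] by blast
    obtain c' where c': "c' \<in> C" "e' = {z, \<sigma> c' z}"
      using edge_at[OF e(2) z(2)] by blast
    have "c \<noteq> c'"
      using ne c c' by blast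
    then show "f e \<noteq> f e'"
      using f c c' comp by (auto simp: compatible_def dest: inj_onD)
  qed
  then show thesis
    using that f by blast
qed

section \<open>Local recolourings\<close>

text \<open>As \<open>\<sigma> a\<close> and \<open>\<sigma> b\<close> commute, the \<open>a\<close>-\<open>b\<close> alternating walk from \<open>u\<close> closes after four steps.
  Exchanging \<open>a\<close> and \<open>b\<close> at its vertices is consistent because these form a set closed under
  \<open>\<sigma> a\<close> and \<open>\<sigma> b\<close>. The case \<open>a = b\<close> is included; nothing is changed then.\<close>

lemma local_recoloring_square:
  assumes u: "u \<in> verts G" and ab: "a \<in> C" "b \<in> C"
    and comm: "\<And>x. x \<in> verts G \<Longrightarrow> \<sigma> a (\<sigma> b x) = \<sigma> b (\<sigma> a x)"
  shows "\<exists>\<pi>. local_recoloring {u, \<sigma> a u} \<pi> \<and> \<pi> u a = b"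
proof -
  define Q where "Q = {u, \<sigma> a u, \<sigma> b u, \<sigma> b (\<sigma> a u)}"
  define \<pi> where "\<pi> x = (if x \<in> Q then transpose a b else id)" for x
  have Q: "x \<in> verts G" "\<sigma> a x \<in> Q" "\<sigma> b x \<in> Q" if "x \<in> Q" for x
    using that u ab closed invol comm by (auto simp: Q_def)
  have Q_iff: "\<sigma> c x \<in> Q \<longleftrightarrow> x \<in> Q" if "c = a \<or> c = b" "x \<in> verts G" for c x
    using Q[of x] Q[of "\<sigma> c x"] that invol ab by auto
  have "compatible \<pi>"
    unfolding compatible_def
  proof (intro ballI conjI)
    fix x c assume x: "x \<in> verts G" and "c \<in> C"
    show "\<pi> (\<sigma> c x) c = \<pi> x c"
      using Q_iff[of c x] x by (cases "c = a \<or> c = b") (auto simp: \<pi>_def)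
  qed (use ab in \<open>auto simp: \<pi>_def transpose_def inj_on_def\<close>)
  moreover have "near {u, \<sigma> a u} x" if "x \<in> Q" for x
    using that u ab closed edgeI unfolding near_def Q_def by blast
  then have "touches {u, \<sigma> a u} x c" if "\<pi> x c \<noteq> c" for x c
    using that by (auto simp: \<pi>_def touches_def split: if_splits)
  ultimately show ?thesis
    by (intro exI[of _ \<pi>]) (auto simp: local_recoloring_def \<pi>_def Q_def)
qed

text \<open>The recoloured edges form a ladder, with the rows
  \<open>\<sigma> b u, u, \<sigma> a u, \<sigma> b (\<sigma> a u)\<close> and the image of this row under \<open>\<sigma> c\<close>, and with rungs of colour \<open>c\<close>.
  The colours \<open>b\<close> and \<open>c\<close> are exchanged on its two outer squares, then \<open>a\<close> and \<open>b\<close> on the inner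
  square. The combined effect is the cycle \<open>a \<mapsto> b \<mapsto> c \<mapsto> a\<close> at the inner vertices and the
  exchange of \<open>b\<close> and \<open>c\<close> at the outer ones. The last assumption keeps inner and outer vertices
  apart.\<close>

lemma local_recoloring_ladder:
  assumes u: "u \<in> verts G" and abc: "a \<in> C" "b \<in> C" "c \<in> C" "a \<noteq> b" "c \<noteq> a" "c \<noteq> b"
    and comm: "\<And>x. x \<in> verts G \<Longrightarrow> \<sigma> c (\<sigma> a x) = \<sigma> a (\<sigma> c x)"
      "\<And>x. x \<in> verts G \<Longrightarrow> \<sigma> c (\<sigma> b x) = \<sigma> b (\<sigma> c x)"
    and no_triangle: "\<And>x. x \<in> verts G \<Longrightarrow> \<sigma> b x \<noteq> \<sigma> c (\<sigma> a x)"
  shows "\<exists>\<pi>. local_recoloring {u, \<sigma> a u} \<pi> \<and> \<pi> u a = b"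
proof -
  define Inner where "Inner = {u, \<sigma> a u, \<sigma> c u, \<sigma> c (\<sigma> a u)}"
  define Outer where "Outer = \<sigma> b ` Inner"
  define \<pi> where "\<pi> x = (if x \<in> Inner then transpose a b \<circ> transpose b c
                          else if x \<in> Outer then transpose b c else id)" for x
  have InnerV: "x \<in> verts G" if "x \<in> Inner" for x
    using that u abc closed by (auto simp: Inner_def)
  have Inner: "\<sigma> a x \<in> Inner" "\<sigma> c x \<in> Inner" if "x \<in> Inner" for x
    using that u abc closed invol comm by (auto simp: Inner_def; metis)+
  have Inner_iff: "\<sigma> k x \<in> Inner \<longleftrightarrow> x \<in> Inner" if "k = a \<or> k = c" "x \<in> verts G" for k x
    using Inner[of x] Inner[of "\<sigma> k x"] that invol abc by auto
  have Oc: "\<sigma> c x \<in> Outer" if x: "x \<in> Outer" for x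
  proof -
    obtain y where y: "y \<in> Inner" "x = \<sigma> b y"
      using x by (auto simp: Outer_def)
    then have "\<sigma> c x = \<sigma> b (\<sigma> c y)"
      using comm InnerV by auto
    then show ?thesis
      using Inner(2)[OF y(1)] by (auto simp: Outer_def)
  qed
  have Oc_iff: "\<sigma> c x \<in> Outer \<longleftrightarrow> x \<in> Outer" if "x \<in> verts G" for x
    using Oc[of x] Oc[of "\<sigma> c x"] that invol abc by auto
  have Ob: "\<sigma> b x \<in> Outer \<longleftrightarrow> x \<in> Inner" if "x \<in> verts G" for x
    using that InnerV invol abc by (auto simp: Outer_def) metis
  have Ob': "\<sigma> b x \<in> Inner \<longleftrightarrow> x \<in> Outer" if "x \<in> verts G" for x
    using Ob[of "\<sigma> b x"] that invol closed abc by auto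
  have disj: "x \<notin> Outer" if "x \<in> Inner" for x
  proof
    \<comment> \<open>The inner square can be described starting from any of its vertices.\<close>
    have Inner': "Inner = {x, \<sigma> a x, \<sigma> c x, \<sigma> c (\<sigma> a x)}"
      using that u abc closed invol comm unfolding Inner_def by (elim insertE) auto
    assume "x \<in> Outer"
    then have "\<sigma> b x \<in> Inner"
      using Ob' InnerV that by blast
    then show False
      using Inner' InnerV[OF that] abc simple no_fixpoint no_triangle by auto
  qed
  have "compatible \<pi>"
    unfolding compatible_def
  proof (intro ballI conjI)
    fix x assume x: "x \<in> verts G"
    show "inj_on (\<pi> x) C" "\<pi> x ` C \<subseteq> C"
      using abc by (auto simp: \<pi>_def transpose_def inj_on_def)
    fix k assume "k \<in> C"
    consider "k = a" | "k = b" | "k = c" | "k \<notin> {a, b, c}"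
      by blast
    then show "\<pi> (\<sigma> k x) k = \<pi> x k"
    proof cases
      case 1
      then show ?thesis
        using Inner_iff[of k x] x abc by (auto simp: \<pi>_def)
    next
      case 2
      then show ?thesis
        using Ob[OF x] Ob'[OF x] disj abc by (auto simp: \<pi>_def)
    next
      case 3
      then show ?thesis
        using Inner_iff[of k x] Oc_iff[OF x] x by (auto simp: \<pi>_def)
    qed (auto simp: \<pi>_def)
  qed
  moreover have near_Inner: "near {u, \<sigma> a u} x" if "x \<in> Inner" for x
    using that u abc closed edgeI unfolding near_def Inner_def by blast
  have "touches {u, \<sigma> a u} x k" if x: "x \<in> verts G" "k \<in> C" "\<pi> x k \<noteq> k" for x k
  proof (cases "x \<in> Inner")
    case True
    then show ?thesis
      using near_Inner by (simp add: touches_def)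
  next
    case False
    then have "x \<in> Outer" "k = b \<or> k = c"
      using x by (auto simp: \<pi>_def transpose_def split: if_splits)
    then obtain y where y: "y \<in> Inner" "x = \<sigma> b y"
      by (auto simp: Outer_def)
    \<comment> \<open>An outer vertex need not be near \<open>e\<close>, but then its neighbours along the edges of colour \<open>b\<close>
      and \<open>c\<close> are.\<close>
    consider "k = b" | "k = c" "y \<in> {u, \<sigma> a u}" | "k = c" "\<sigma> c y \<in> {u, \<sigma> a u}"
      using \<open>k = b \<or> k = c\<close> y(1) u abc closed invol unfolding Inner_def by auto
    then show ?thesis
    proof cases
      case 1
      then have "\<sigma> k x \<in> Inner"
        using y InnerV invol abc by auto
      then show ?thesis
        using near_Inner by (simp add: touches_def)
    next
      case 2
      then have "near {u, \<sigma> a u} x"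
        using y InnerV edgeI abc unfolding near_def by blast
      then show ?thesis
        by (simp add: touches_def)
    next
      case 3
      have "\<sigma> k x = \<sigma> b (\<sigma> c y)" "\<sigma> c y \<in> verts G"
        using y InnerV comm closed abc 3 by auto
      then have "near {u, \<sigma> a u} (\<sigma> k x)"
        using 3 edgeI abc unfolding near_def by metis
      then show ?thesis
        by (simp add: touches_def)
    qed
  qed
  ultimately show ?thesis
    using abc by (intro exI[of _ \<pi>]) (auto simp: local_recoloring_def \<pi>_def Inner_def)
qed

section \<open>Extending a distance-4 matching\<close>

text \<open>At a vertex \<open>x\<close>, each \<open>\<rho> e x\<close> maps the set of colours that it moves into itself, by
  injectivity. By separation these sets are disjoint for different \<open>e\<close>, so the maps can be glued
  without losing injectivity.\<close>

lemma combine_local_recolorings: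
  assumes loc: "\<And>e. e \<in> M \<Longrightarrow> local_recoloring e (\<rho> e)"
    and sep: "\<And>e e' x c. e \<in> M \<Longrightarrow> e' \<in> M \<Longrightarrow> x \<in> verts G \<Longrightarrow> c \<in> C \<Longrightarrow>
                touches e x c \<Longrightarrow> touches e' x c \<Longrightarrow> e = e'"
  obtains \<pi> where "compatible \<pi>"
    "\<And>e x c. e \<in> M \<Longrightarrow> x \<in> verts G \<Longrightarrow> c \<in> C \<Longrightarrow> touches e x c \<Longrightarrow> \<pi> x c = \<rho> e x c"
proof -
  define \<pi> where "\<pi> x c = (if \<exists>e\<in>M. touches e x c then \<rho> (SOME e. e \<in> M \<and> touches e x c) x c
                            else c)" for x c
  have eq: "\<pi> x c = \<rho> e x c" if "e \<in> M" "x \<in> verts G" "c \<in> C" "touches e x c" for e x c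
  proof -
    have "(SOME e. e \<in> M \<and> touches e x c) = e"
      using that sep by (intro some_equality) auto
    then show ?thesis
      using that by (auto simp: \<pi>_def)
  qed
  have inj: "inj_on (\<rho> e x) C" and mem: "c \<in> C \<Longrightarrow> \<rho> e x c \<in> C"
    and inv: "c \<in> C \<Longrightarrow> \<rho> e (\<sigma> c x) c = \<rho> e x c"
    and moves: "c \<in> C \<Longrightarrow> \<rho> e x c \<noteq> c \<Longrightarrow> touches e x c"
    if "e \<in> M" "x \<in> verts G" for e x c
    using loc[OF that(1)] that(2) unfolding local_recoloring_def compatible_def by auto
  have moved: "\<exists>e\<in>M. \<pi> x c = \<rho> e x c \<and> \<rho> e x (\<pi> x c) \<noteq> \<pi> x c"
    if x: "x \<in> verts G" "c \<in> C" and "\<pi> x c \<noteq> c" for x c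
  proof -
    obtain e where e: "e \<in> M" "touches e x c"
      using \<open>\<pi> x c \<noteq> c\<close> by (auto simp: \<pi>_def split: if_splits)
    then have "\<pi> x c = \<rho> e x c"
      using eq x by blast
    moreover from this have "\<rho> e x (\<pi> x c) \<noteq> \<pi> x c"
      using inj[OF e(1) x(1)] mem[OF e(1) x(1)] x(2) \<open>\<pi> x c \<noteq> c\<close> by (metis inj_onD)
    ultimately show ?thesis
      using e by blast
  qed
  have CC: "\<pi> x c \<in> C" if "x \<in> verts G" "c \<in> C" for x c
    using moved[OF that] mem that by (cases "\<pi> x c = c") auto
  \<comment> \<open>A moved colour is never sent to a colour left in place: the map that moved it would also
    move its image.\<close>
  have fixed: "c = c'" if x: "x \<in> verts G" "c \<in> C" "c' \<in> C" and k: "\<pi> x c = c'" "\<pi> x c' = c'" for x c c'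
  proof (rule ccontr)
    assume "c \<noteq> c'"
    then obtain e where "e \<in> M" "\<rho> e x c' \<noteq> c'"
      using moved[of x c] x k by auto
    then show False
      using eq[of e x c'] moves[of e x c'] x k by auto
  qed
  have "compatible \<pi>"
    unfolding compatible_def
  proof (intro ballI conjI inj_onI)
    fix x assume x: "x \<in> verts G"
    show "\<pi> x ` C \<subseteq> C"
      using CC x by auto
    fix c assume c: "c \<in> C"
    have "touches e (\<sigma> c x) c \<longleftrightarrow> touches e x c" for e
      using invol[OF c x] by (auto simp: touches_def)
    then show "\<pi> (\<sigma> c x) c = \<pi> x c"
      using inv[OF _ x c] someI_ex[of "\<lambda>e. e \<in> M \<and> touches e x c"] by (auto simp: \<pi>_def)
    fix c' assume c': "c' \<in> C" and k: "\<pi> x c = \<pi> x c'"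
    show "c = c'"
    proof (cases "\<pi> x c = c \<or> \<pi> x c' = c'")
      case True
      then show ?thesis
        using fixed[OF x c c'] fixed[OF x c' c] k by auto
    next
      case False
      then obtain e e' where e: "e \<in> M" "\<pi> x c = \<rho> e x c" "\<rho> e x (\<pi> x c) \<noteq> \<pi> x c"
        and e': "e' \<in> M" "\<pi> x c' = \<rho> e' x c'" "\<rho> e' x (\<pi> x c) \<noteq> \<pi> x c"
        using moved[OF x c] moved[OF x c'] k by auto
      have "e = e'"
        using sep[OF e(1) e'(1) x CC[OF x c]] moves e e' x c CC by blast
      then show ?thesis
        using inj[OF e(1) x] e e' k c c' by (auto dest: inj_onD)
    qed
  qed
  then show thesis
    using that eq by blast
qed

lemma near_in_verts: "e \<in> edges G \<Longrightarrow> near e x \<Longrightarrow>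
   \<exists>y\<in>e. y \<in> verts G \<and> (y = x \<or> {y, x} \<in> edges G)"
  unfolding near_def using edge_at by metis

lemma touches_unique:
  assumes M: "distance_matching G 4 M" and e: "e \<in> M" "e' \<in> M" and x: "x \<in> verts G" "c \<in> C"
    and t: "touches e x c" "touches e' x c"
  shows "e = e'"
proof (rule ccontr)
  assume "e \<noteq> e'"
  then have far: "enat 4 \<le> edge_dist G e e'"
    using M e by (auto simp: distance_matching_def)
  have E: "e \<in> edges G" "e' \<in> edges G"
    using M e by (auto simp: distance_matching_def matching_def)
  \<comment> \<open>The walk \<open>w, y, z, v\<close> from \<open>e\<close> to \<open>e'\<close> passes through the edge \<open>{x, \<sigma> c x}\<close> touched by both;
    some of its steps may stand still.\<close>
  obtain y where y: "y \<in> {x, \<sigma> c x}" "near e y"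
    using t(1) by (auto simp: touches_def)
  obtain z where z: "z \<in> {x, \<sigma> c x}" "near e' z"
    using t(2) by (auto simp: touches_def)
  obtain w where w: "w \<in> e" "w \<in> verts G" "w = y \<or> {w, y} \<in> edges G"
    using near_in_verts[OF E(1) y(2)] by blast
  obtain v where v: "v \<in> e'" "v \<in> verts G" "v = z \<or> {v, z} \<in> edges G"
    using near_in_verts[OF E(2) z(2)] by blast
  have "y = z \<or> {y, z} \<in> edges G" "y \<in> verts G" "z \<in> verts G"
    using y z edgeI[OF x] closed[OF x(2,1)] x by (auto simp: insert_commute)
  then have "edge_dist G e e' \<le> enat 3"
    using w v by (intro edge_dist_le_3[of w y z v]) (auto simp: insert_commute)
  with far have "enat 4 \<le> enat 3"
    by (rule order_trans)
  then show False
    by simp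
qed

text \<open>The alternatives in \<open>switch\<close> are what the square and the ladder require. An edge that already
  has its prescribed colour falls under the square with \<open>a = b\<close>.\<close>

theorem distance_matching_coloring_extends:
  assumes C: "C = {1..t}"
    and M: "distance_matching G 4 M" and \<phi>: "\<forall>e\<in>M. \<phi> e \<in> C"
    and switch: "\<And>a b. a \<in> C \<Longrightarrow> b \<in> C \<Longrightarrow> a \<noteq> b \<Longrightarrow>
      (\<forall>x\<in>verts G. \<sigma> a (\<sigma> b x) = \<sigma> b (\<sigma> a x)) \<or>
      (\<exists>c\<in>C. c \<noteq> a \<and> c \<noteq> b \<and> (\<forall>x\<in>verts G. \<sigma> c (\<sigma> a x) = \<sigma> a (\<sigma> c x) \<and>
         \<sigma> c (\<sigma> b x) = \<sigma> b (\<sigma> c x) \<and> \<sigma> b x \<noteq> \<sigma> c (\<sigma> a x)))"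
  shows "\<exists>f. proper_edge_coloring G t f \<and> (\<forall>e\<in>M. f e = \<phi> e)"
proof -
  have "\<exists>\<pi>. local_recoloring e \<pi> \<and> (\<exists>u\<in>verts G. \<exists>a\<in>C. e = {u, \<sigma> a u} \<and> \<pi> u a = \<phi> e)"
    if e: "e \<in> M" for e
  proof -
    obtain u a where u: "u \<in> verts G" "a \<in> C" "e = {u, \<sigma> a u}"
      using M e by (auto simp: distance_matching_def matching_def edges_eq)
    have b: "\<phi> e \<in> C"
      using \<phi> e by blast
    have "\<exists>\<pi>. local_recoloring {u, \<sigma> a u} \<pi> \<and> \<pi> u a = \<phi> e"
    proof (cases "\<forall>x\<in>verts G. \<sigma> a (\<sigma> (\<phi> e) x) = \<sigma> (\<phi> e) (\<sigma> a x)")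
      case True
      then show ?thesis
        using local_recoloring_square[OF u(1,2) b] by blast
    next
      case False
      then have ne: "a \<noteq> \<phi> e"
        by auto
      then obtain c where "c \<in> C" "c \<noteq> a" "c \<noteq> \<phi> e" "\<forall>x\<in>verts G. \<sigma> c (\<sigma> a x) = \<sigma> a (\<sigma> c x) \<and>
         \<sigma> c (\<sigma> (\<phi> e) x) = \<sigma> (\<phi> e) (\<sigma> c x) \<and> \<sigma> (\<phi> e) x \<noteq> \<sigma> c (\<sigma> a x)"
        using switch[OF u(2) b] False by blast
      then show ?thesis
        using local_recoloring_ladder[OF u(1,2) b _ ne] by blast
    qed
    then show ?thesis
      using u by blast
  qed
  then obtain \<rho> where \<rho>: "\<And>e. e \<in> M \<Longrightarrow> local_recoloring e (\<rho> e)"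
    "\<And>e. e \<in> M \<Longrightarrow> \<exists>u\<in>verts G. \<exists>a\<in>C. e = {u, \<sigma> a u} \<and> \<rho> e u a = \<phi> e"
    by metis
  obtain \<pi> where \<pi>: "compatible \<pi>"
    "\<And>e x c. e \<in> M \<Longrightarrow> x \<in> verts G \<Longrightarrow> c \<in> C \<Longrightarrow> touches e x c \<Longrightarrow> \<pi> x c = \<rho> e x c"
    using combine_local_recolorings[of M \<rho>] \<rho>(1) touches_unique[OF M] by blast
  obtain f where f: "proper_edge_coloring G t f"
    "\<And>x c. x \<in> verts G \<Longrightarrow> c \<in> C \<Longrightarrow> f {x, \<sigma> c x} = \<pi> x c"
    using coloring_of_compatible[OF \<pi>(1) C] by blast
  have "f e = \<phi> e" if e: "e \<in> M" for e
  proof -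
    obtain u a where u: "u \<in> verts G" "a \<in> C" "e = {u, \<sigma> a u}" "\<rho> e u a = \<phi> e"
      using \<rho>(2) e by blast
    then have "touches e u a"
      by (auto simp: touches_def near_def)
    then show ?thesis
      using u \<pi>(2) f(2) e by metis
  qed
  then show ?thesis
    using f by blast
qed

end

section \<open>Powers of even cycles\<close>

text \<open>The neighbour of \<open>m\<close> on the \<open>n\<close>-cycle along the perfect matching that contains the edge from
  \<open>m\<close> to \<open>m + 1\<close> iff \<open>m + c\<close> is even. Only the parity of \<open>c\<close> matters, so that colours can be used
  for \<open>c\<close> directly: \<open>2i + 1\<close> and \<open>2i + 2\<close> give the two matchings.\<close>

definition cycle_flip :: "nat \<Rightarrow> nat \<Rightarrow> nat \<Rightarrow> nat" where
  "cycle_flip n c m = (if even (m + c) then Suc m mod n else (m + n - 1) mod n)"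

lemma cycle_flip_eq:
  assumes "m < n"
  shows "cycle_flip n c m = (if even (m + c) then if Suc m = n then 0 else Suc m
                             else if m = 0 then n - 1 else m - 1)"
proof -
  have "(m + n - 1) mod n = (if m = 0 then n - 1 else m - 1)"
    using assms by (cases m) auto
  then show ?thesis
    using assms by (auto simp: cycle_flip_def)
qed

lemma cycle_flip:
  assumes "even n" "n \<ge> 4" "m < n"
  shows "cycle_flip n c m < n" "cycle_flip n c (cycle_flip n c m) = m" "cycle_flip n c m \<noteq> m"
    "even (c + c') \<or> cycle_flip n c m \<noteq> cycle_flip n c' m"
proof -
  show lt: "cycle_flip n c m < n"
    using assms by (auto simp: cycle_flip_eq)
  show "cycle_flip n c m \<noteq> m"
    using assms by (auto simp: cycle_flip_eq)
  show "even (c + c') \<or> cycle_flip n c m \<noteq> cycle_flip n c' m"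
    using assms by (auto simp: cycle_flip_eq)
  show "cycle_flip n c (cycle_flip n c m) = m"
    unfolding cycle_flip_eq[OF lt] using assms by (auto simp: cycle_flip_eq)
qed

lemma cycle_edge_iff:
  assumes "even n" "n \<ge> 4" "m < n" "m' < n"
  shows "{m, m'} \<in> edges (cycle_graph n) \<longleftrightarrow> m' = cycle_flip n 0 m \<or> m' = cycle_flip n 1 m"
proof -
  have "{m, m'} \<in> edges (cycle_graph n) \<longleftrightarrow> m' = Suc m mod n \<or> m = Suc m' mod n"
    using assms by (auto simp: cycle_graph_def doubleton_eq_iff)
  also have "\<dots> \<longleftrightarrow> m' = (if Suc m = n then 0 else Suc m) \<or> m = (if Suc m' = n then 0 else Suc m')"
    using assms by simp
  also have "\<dots> \<longleftrightarrow> m' = cycle_flip n 0 m \<or> m' = cycle_flip n 1 m"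
    using assms by (auto simp: cycle_flip_eq)
  finally show ?thesis .
qed

text \<open>The colours \<open>2i + 1\<close> and \<open>2i + 2\<close> belong to direction \<open>i\<close>, whence \<open>(c - 1) div 2\<close>.\<close>

definition power_flip :: "nat \<Rightarrow> nat \<Rightarrow> nat list \<Rightarrow> nat list" where
  "power_flip n c xs = (let i = (c - 1) div 2 in xs[i := cycle_flip n c (xs ! i)])"

lemma edges_cart_power_doubleton:
  assumes "e \<in> edges (cart_power G d)"
  obtains xs ys where "e = {xs, ys}"
  using assms by (cases d) (auto simp: map_ugraph_def cart_prod_def)

lemma involution_graph_cycle_power:
  assumes "even n" "n \<ge> 4"
  shows "involution_graph (cart_power (cycle_graph n) d) {1..2 * d} (power_flip n)"
proof
  let ?G = "cart_power (cycle_graph n) d" and ?i = "\<lambda>c::nat. (c - 1) div 2"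
  have V: "xs \<in> verts ?G \<longleftrightarrow> length xs = d \<and> (\<forall>i<d. xs ! i < n)" for xs
    by (auto simp: verts_cart_power cycle_graph_def subset_iff in_set_conv_nth)
  have i: "?i c < d" if "c \<in> {1..2 * d}" for c
    using that by auto
  note flip = cycle_flip[OF assms]
  fix c xs assume c: "c \<in> {1..2 * d}" and xs: "xs \<in> verts ?G"
  have *: "length xs = d" "xs ! ?i c < n"
    using xs V i[OF c] by auto
  show "power_flip n c xs \<in> verts ?G"
    using xs i[OF c] flip(1) by (auto simp: V power_flip_def Let_def nth_list_update)
  show "power_flip n c (power_flip n c xs) = xs"
    using * i[OF c] flip(2) by (simp add: power_flip_def Let_def)
  show "power_flip n c xs \<noteq> xs"
    using * i[OF c] flip(3) unfolding power_flip_def Let_def by (metis nth_list_update_eq)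
  fix c' assume c': "c' \<in> {1..2 * d}" and eq: "power_flip n c xs = power_flip n c' xs"
  have "?i c = ?i c'"
  proof (rule ccontr)
    assume "?i c \<noteq> ?i c'"
    then have "power_flip n c xs ! ?i c \<noteq> power_flip n c' xs ! ?i c"
      using * i[OF c] flip(3) by (simp add: power_flip_def Let_def)
    then show False
      using eq by simp
  qed
  moreover have "cycle_flip n c (xs ! ?i c) = cycle_flip n c' (xs ! ?i c)"
    using eq * i[OF c] \<open>?i c = ?i c'\<close> unfolding power_flip_def Let_def by (metis nth_list_update_eq)
  then have "even (c + c')"
    using flip(4)[OF *(2)] by blast
  ultimately show "c = c'"
    using c c' by simp presburger
next
  let ?G = "cart_power (cycle_graph n) d" and ?i = "\<lambda>c::nat. (c - 1) div 2"
  have V: "xs \<in> verts ?G \<longleftrightarrow> length xs = d \<and> (\<forall>i<d. xs ! i < n)" for xs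
    by (auto simp: verts_cart_power cycle_graph_def subset_iff in_set_conv_nth)
  have "i \<noteq> Suc i mod n" if "i < n" for i
    using that assms by (cases "Suc i = n") auto
  then have noloop: "{x} \<notin> edges (cycle_graph n)" for x
    by (auto simp: cycle_graph_def singleton_insert_inj_eq) metis
  have "{xs, ys} \<in> edges ?G \<longleftrightarrow> xs \<in> verts ?G \<and> (\<exists>c\<in>{1..2*d}. ys = power_flip n c xs)"
    (is "?L \<longleftrightarrow> ?R") for xs ys
  proof
    assume ?L
    then obtain i where i: "i < d" "{xs ! i, ys ! i} \<in> edges (cycle_graph n)"
        "\<forall>j<d. j \<noteq> i \<longrightarrow> xs ! j = ys ! j" and xy: "xs \<in> verts ?G" "ys \<in> verts ?G"
      unfolding edges_cart_power[OF noloop] by blast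
    have "ys ! i = cycle_flip n 0 (xs ! i) \<or> ys ! i = cycle_flip n 1 (xs ! i)"
      using i(1,2) xy cycle_edge_iff[OF assms] V by blast
    then have "\<exists>c\<in>{2 * i + 1, 2 * i + 2}. ys ! i = cycle_flip n c (xs ! i)"
      by (auto simp: cycle_flip_def)
    then obtain c where c: "c \<in> {2 * i + 1, 2 * i + 2}" "ys ! i = cycle_flip n c (xs ! i)"
      by blast
    have "(c - 1) div 2 = i" "c \<in> {1..2 * d}"
      using c(1) i(1) by auto
    moreover from this have "ys = power_flip n c xs"
      using c(2) i xy by (intro nth_equalityI) (auto simp: V power_flip_def Let_def nth_list_update)
    ultimately show ?R
      using xy by blast
  next
    assume ?R
    then obtain c where c: "c \<in> {1..2 * d}" and ys: "ys = power_flip n c xs" and xs: "xs \<in> verts ?G"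
      by blast
    have i: "?i c < d"
      using c by auto
    then have lt: "xs ! ?i c < n" "length xs = d"
      using xs V by auto
    have "cycle_flip n c (xs ! ?i c) = cycle_flip n 0 (xs ! ?i c) \<or>
        cycle_flip n c (xs ! ?i c) = cycle_flip n 1 (xs ! ?i c)"
      by (auto simp: cycle_flip_def)
    then have "{xs ! ?i c, cycle_flip n c (xs ! ?i c)} \<in> edges (cycle_graph n)"
      using cycle_edge_iff[OF assms lt(1) cycle_flip(1)[OF assms lt(1)]] by blast
    moreover have "ys \<in> verts ?G"
      using xs i cycle_flip(1)[OF assms] by (auto simp: V ys power_flip_def Let_def nth_list_update)
    ultimately show ?L
      unfolding edges_cart_power[OF noloop] using xs lt i
      by (auto simp: ys power_flip_def Let_def intro!: exI[of _ "?i c"])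
  qed
  note iff = this
  show "edges ?G = {{x, power_flip n c x} |x c. x \<in> verts ?G \<and> c \<in> {1..2 * d}}"
  proof (intro equalityI subsetI)
    fix e assume e: "e \<in> edges ?G"
    then obtain xs ys where "e = {xs, ys}"
      by (rule edges_cart_power_doubleton)
    then show "e \<in> {{x, power_flip n c x} |x c. x \<in> verts ?G \<and> c \<in> {1..2 * d}}"
      using e iff[of xs ys] by blast
  qed (use iff in blast)
qed

lemma power_flip_commute:
  assumes "(a - 1) div 2 \<noteq> (b - 1) div 2"
  shows "power_flip n a (power_flip n b xs) = power_flip n b (power_flip n a xs)"
  using assms by (simp add: power_flip_def Let_def list_update_swap)

theorem theorem5p1:
  fixes k d :: nat and M :: "nat list set set" and \<phi> :: "nat list set \<Rightarrow> nat"
  assumes "k \<ge> 2" and "d \<ge> 2"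
    and "distance_matching (cart_power (cycle_graph (2 * k)) d) 4 M"
    and "\<forall>e\<in>M. \<phi> e \<in> {1..2 * d}"
  shows "\<exists>f. proper_edge_coloring (cart_power (cycle_graph (2 * k)) d) (2 * d) f \<and>
             (\<forall>e\<in>M. f e = \<phi> e)"
proof -
  let ?G = "cart_power (cycle_graph (2 * k)) d"
  have n: "even (2 * k)" "2 * k \<ge> 4"
    using assms(1) by auto
  interpret involution_graph ?G "{1..2 * d}" "power_flip (2 * k)"
    by (rule involution_graph_cycle_power[OF n])
  let ?\<sigma> = "power_flip (2 * k)" and ?i = "\<lambda>c::nat. (c - 1) div 2"
  show ?thesis
  proof (rule distance_matching_coloring_extends[OF refl assms(3,4)])
    fix a b assume ab: "a \<in> {1..2 * d}" "b \<in> {1..2 * d}"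
    show "(\<forall>x\<in>verts ?G. ?\<sigma> a (?\<sigma> b x) = ?\<sigma> b (?\<sigma> a x)) \<or>
      (\<exists>c\<in>{1..2 * d}. c \<noteq> a \<and> c \<noteq> b \<and> (\<forall>x\<in>verts ?G. ?\<sigma> c (?\<sigma> a x) = ?\<sigma> a (?\<sigma> c x) \<and>
         ?\<sigma> c (?\<sigma> b x) = ?\<sigma> b (?\<sigma> c x) \<and> ?\<sigma> b x \<noteq> ?\<sigma> c (?\<sigma> a x)))"
    proof (cases "?i a = ?i b")
      case False
      then show ?thesis
        using power_flip_commute by blast
    next
      case True
      \<comment> \<open>Colour \<open>3\<close> belongs to direction \<open>1\<close>, which is present because \<open>d \<ge> 2\<close>.\<close>
      define c :: nat where "c = (if ?i a = 0 then 3 else 1)"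
      have c: "?i c \<noteq> ?i a" "?i c \<noteq> ?i b" "c \<in> {1..2 * d}" "?i c < d"
        using True assms(2) by (auto simp: c_def)
      have "?\<sigma> b x \<noteq> ?\<sigma> c (?\<sigma> a x)" if x: "x \<in> verts ?G" for x
      proof -
        have "x ! ?i c < 2 * k" "length x = d"
          using x c(4) by (auto simp: verts_cart_power cycle_graph_def subset_iff)
        then have "?\<sigma> b x ! ?i c \<noteq> ?\<sigma> c (?\<sigma> a x) ! ?i c"
          using c cycle_flip(3)[OF n, of "x ! ?i c" c] by (simp add: power_flip_def Let_def)
        then show ?thesis
          by metis
      qed
      moreover have "c \<noteq> a" "c \<noteq> b"
        using c by auto
      ultimately show ?thesis
        using c power_flip_commute by blast
    qed
  qed
qed

end
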